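(* Let $G$ be a connected graph with $n$ vertices, and let $M$ be a maximum matching of $G$ such that the number of isolated vertices of $G[D(G)]$ covered by $M$ is maximized (among all maximum matchings of $G$). Let $M(G)$ denote the number of components of $G[D(G)]$ of order at least $3$ that have exactly one vertex not covered by $M$. Then $$\eta_{per}(G)=\begin{cases} n-2\nu(G) & \text{if } G \text{ has a perfect matching or } \mathcal{F}(G)=\emptyset,\\ n-2\nu(G)-M(G) & \text{otherwise.}\end{cases}$$
   Context: All graphs are finite and simple. For a graph $G$ with $n$ vertices and adjacency matrix $A(G)$, the permanental polynomial is $\pi(G,x)=\mathrm{per}(xI-A(G))$, where $\mathrm{per}(A)=\sum_{\sigma}\prod_{i=1}^n a_{i\sigma(i)}$ with $\sigma$ ranging over all permutations of $\{1,\dots,n\}$. The permanental nullity $\eta_{per}(G)$ is the multiplicity of $0$ as a root of $\pi(G,x)$ (it is $0$ if $0$ is not a root). $\nu(G)$ is the matching number, i.e. the size of a maximum matching of $G$. A vertex is covered by a matching $M$ if some edge of $M$ is incident with it; a perfect matching covers all vertices. $D(G)$ is the set of all vertices of $G$ that are left uncovered by at least one maximum matching of $G$; $G[D(G)]$ is the subgraph induced by $D(G)$; $\mathcal{F}(G)$ is the set of connected components of $G[D(G)]$ having at least $3$ vertices. *)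

theory Defs
  imports
    Graph_Theory.Digraph_Component
    "HOL-Computational_Algebra.Polynomial"
    "HOL-Combinatorics.Permutations"
begin

text \<open>
  Finite simple graphs are the locale \<open>Digraph.graph\<close>: a finite symmetric digraph without loops
  and multiple arcs, so that an undirected edge \<open>{u, v}\<close> is a pair of opposite arcs. Constants
  such as \<open>Digraph.graph\<close> and \<open>Digraph_Component.connected\<close> are written with their theory prefix
  because \<open>Map\<close> and \<open>Topological_Spaces\<close> use the same base names.
\<close>

subsection \<open>The permanental polynomial\<close>

text \<open>
  A square matrix is a function of two indices ranging over a finite set \<open>I\<close>. The rows and columns
  of the adjacency matrix are indexed by the vertices themselves; by \<open>permanent_reindex\<close>
  numbering the vertices by \<open>1, \<dots>, n\<close> in any way gives the same permanent.
\<close>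

definition permanent :: "'i set \<Rightarrow> ('i \<Rightarrow> 'i \<Rightarrow> 'c::comm_semiring_1) \<Rightarrow> 'c" where
  "permanent I A = (\<Sum>\<sigma> | \<sigma> permutes I. \<Prod>i\<in>I. A i (\<sigma> i))"

lemma permanent_reindex:
  assumes f: "bij_betw f I J"
  shows "permanent J A = permanent I (\<lambda>i j. A (f i) (f j))"
proof -
  let ?h = "\<lambda>\<pi> x. if x \<in> J then f (\<pi> (inv_into I f x)) else x"
  have "permanent J A = (\<Sum>\<pi> | \<pi> permutes I. \<Prod>j\<in>J. A j (?h \<pi> j))"
    unfolding permanent_def
    by (rule sum.reindex_bij_betw[OF bij_betw_permutations[OF f], symmetric])
  also have "\<dots> = (\<Sum>\<pi> | \<pi> permutes I. \<Prod>i\<in>I. A (f i) (?h \<pi> (f i)))"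
    by (intro sum.cong refl prod.reindex_bij_betw[OF f, symmetric])
  also have "\<dots> = permanent I (\<lambda>i j. A (f i) (f j))"
    unfolding permanent_def using f
    by (intro sum.cong prod.cong refl) (auto simp: bij_betw_def inv_into_f_f)
  finally show ?thesis .
qed

definition adjacency :: "('a, 'b) pre_digraph \<Rightarrow> 'a \<Rightarrow> 'a \<Rightarrow> real" where
  "adjacency G u v = (if u \<rightarrow>\<^bsub>G\<^esub> v then 1 else 0)"

text \<open>
  \<open>[:0, 1:]\<close> is the indeterminate \<open>x\<close>, and \<open>[:c:]\<close> the constant polynomial \<open>c\<close>.
\<close>

definition permanental_poly :: "('a, 'b) pre_digraph \<Rightarrow> real poly" where
  "permanental_poly G =
     permanent (verts G) (\<lambda>u v. (if u = v then [:0, 1:] else 0) - [:adjacency G u v:])"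

definition permanental_nullity :: "('a, 'b) pre_digraph \<Rightarrow> nat" where
  "permanental_nullity G = order 0 (permanental_poly G)"


subsection \<open>Matchings\<close>

definition edges :: "('a, 'b) pre_digraph \<Rightarrow> 'a set set" where
  "edges G = {{u, v} | u v. u \<rightarrow>\<^bsub>G\<^esub> v}"

definition matching :: "('a, 'b) pre_digraph \<Rightarrow> 'a set set \<Rightarrow> bool" where
  "matching G M \<longleftrightarrow> M \<subseteq> edges G \<and> pairwise disjnt M"

definition covered :: "'a set set \<Rightarrow> 'a set" where
  "covered M = {v. \<exists>e\<in>M. v \<in> e}"

definition perfect_matching :: "('a, 'b) pre_digraph \<Rightarrow> 'a set set \<Rightarrow> bool" where
  "perfect_matching G M \<longleftrightarrow> matching G M \<and> verts G \<subseteq> covered M"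

definition maximum_matching :: "('a, 'b) pre_digraph \<Rightarrow> 'a set set \<Rightarrow> bool" where
  "maximum_matching G M \<longleftrightarrow> matching G M \<and> (\<forall>N. matching G N \<longrightarrow> card N \<le> card M)"

definition matching_number :: "('a, 'b) pre_digraph \<Rightarrow> nat" where
  "matching_number G = Max (card ` {M. matching G M})"


subsection \<open>The subgraph induced by the inessential vertices\<close>

definition D_verts :: "('a, 'b) pre_digraph \<Rightarrow> 'a set" where
  "D_verts G = {v \<in> verts G. \<exists>M. maximum_matching G M \<and> v \<notin> covered M}"

definition D_graph :: "('a, 'b) pre_digraph \<Rightarrow> ('a, 'b) pre_digraph" where
  "D_graph G = G \<restriction> D_verts G"

definition isolated_verts :: "('a, 'b) pre_digraph \<Rightarrow> 'a set" where
  "isolated_verts H = {v \<in> verts H. \<forall>w. \<not> v \<rightarrow>\<^bsub>H\<^esub> w}"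

text \<open>
  In a symmetric digraph the connected components are the strongly connected components.
\<close>

definition nontrivial_components :: "('a, 'b) pre_digraph \<Rightarrow> ('a, 'b) pre_digraph set" where
  "nontrivial_components G = {C \<in> pre_digraph.sccs (D_graph G). 3 \<le> card (verts C)}"

definition missed_components ::
    "('a, 'b) pre_digraph \<Rightarrow> 'a set set \<Rightarrow> ('a, 'b) pre_digraph set" where
  "missed_components G M = {C \<in> nontrivial_components G. card (verts C - covered M) = 1}"

end

theory Submission
  imports Defs "HOL-Number_Theory.Cong"
begin

text \<open>
  A permutation of the vertices with \<open>k\<close> fixed points contributes \<open>\<plusminus> x ^ k\<close> to the permanental
  polynomial if it sends each vertex that it moves to a neighbour, and nothing otherwise. The sign
  depends only on \<open>k\<close>. So nothing cancels, and the permanental nullity is the least number of fixed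
  points of such a permutation (\<open>permanental_nullity_eqI\<close>).

  Let \<open>U\<close> be the set of vertices missed by \<open>M\<close>, and \<open>I\<close> the set of isolated vertices of \<open>G[D(G)]\<close>.
  The least number of fixed points is \<open>|U \<inter> I|\<close>.

  It cannot be smaller. A permutation of this kind sends the vertices of \<open>I\<close> that it moves
  injectively to neighbours, which lie outside \<open>D(G)\<close> and hence outside \<open>I\<close>. This injection is a
  matching, and whatever a matching covers is also covered by some maximum matching
  (\<open>optimal_covers_pairing\<close>). By the choice of \<open>M\<close>, at most \<open>|I - U|\<close> vertices of \<open>I\<close> are moved.

  It is attained. Away from \<open>U\<close> the permutation swaps the ends of each edge of \<open>M\<close>; what remains is
  to move the vertices of \<open>U - I\<close> as well. Such a vertex \<open>u\<close> has a neighbour \<open>t\<close> in \<open>D(G)\<close>. Take a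
  maximum matching \<open>N\<close> that misses \<open>t\<close>. The alternating path of \<open>M\<close> and \<open>N\<close> that starts at \<open>t\<close> must
  end at \<open>u\<close>, since otherwise switching along it would give a maximum matching missing both ends of
  an edge. Together with the edge \<open>ut\<close> this path is an odd cycle, a blossom, and \<open>M\<close> matches its
  vertices other than \<open>u\<close> among themselves. So the permutation may rotate the cycle instead of
  following \<open>M\<close> there. Every vertex of the cycle can be the one that is left out, so the cycle lies
  in the component of \<open>u\<close> in \<open>G[D(G)]\<close> (\<open>blossom_at_unmatched\<close>). By Gallai's lemma
  (\<open>linked_not_both_unmatched\<close>) no component of \<open>G[D(G)]\<close> contains two vertices of \<open>U\<close>, hence the
  blossoms at different vertices are disjoint and can all be rotated at once.

  Finally \<open>|U| = n - 2 \<nu>(G)\<close>, and \<open>u \<mapsto> component of u\<close> is a bijection from \<open>U - I\<close> to the components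
  counted by \<open>M(G)\<close>: each such component has one vertex in \<open>U\<close>, and it has at least three vertices
  because it contains a blossom. Hence \<open>|U \<inter> I| = n - 2 \<nu>(G) - M(G)\<close>, and \<open>M(G) = 0\<close> in the first
  case of the formula.

  Throughout, a matching is represented by the involution of the vertices that swaps the two ends of
  each of its edges and fixes the other vertices. Alternating paths are then orbits of two
  involutions, and switching along one means to replace one involution by the other on a set that
  is closed under both.
\<close>

section \<open>Orbits of two involutions\<close>

text \<open>
  When \<open>n\<close> fixes \<open>t\<close>, this is the vertex set of the alternating path of the matchings \<open>m\<close> and \<open>n\<close>
  that starts at \<open>t\<close>. The two parts are what a walk along the path, by \<open>m\<close> and \<open>n\<close> in turn, visits
  after an even and after an odd number of steps.
\<close>
definition alternating_orbit :: "('a \<Rightarrow> 'a) \<Rightarrow> ('a \<Rightarrow> 'a) \<Rightarrow> 'a \<Rightarrow> 'a set" where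
  "alternating_orbit m n t =
     range (\<lambda>k. ((n \<circ> m) ^^ k) t) \<union> range (\<lambda>k. m (((n \<circ> m) ^^ k) t))"

lemma start_in_alternating_orbit: "t \<in> alternating_orbit m n t"
  unfolding alternating_orbit_def by (auto intro: range_eqI[where x = 0])

lemma alternating_orbit_closed:
  assumes m: "\<And>x. m (m x) = x" and n: "\<And>x. n (n x) = x" and t: "n t = t"
  shows "m ` alternating_orbit m n t \<subseteq> alternating_orbit m n t"
    and "n ` alternating_orbit m n t \<subseteq> alternating_orbit m n t"
proof -
  show "m ` alternating_orbit m n t \<subseteq> alternating_orbit m n t"
    unfolding alternating_orbit_def by (auto simp: m)
  have "n (((n \<circ> m) ^^ k) t) \<in> alternating_orbit m n t" for k
  proof (cases k)
    case 0
    then show ?thesis using start_in_alternating_orbit[of t m n] by (simp add: t)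
  qed (auto simp: alternating_orbit_def n)
  moreover have "n (m (((n \<circ> m) ^^ k) t)) = ((n \<circ> m) ^^ Suc k) t" for k
    by simp
  ultimately show "n ` alternating_orbit m n t \<subseteq> alternating_orbit m n t"
    unfolding alternating_orbit_def by blast
qed

text \<open>
  Conjugation by \<open>m\<close> inverts \<open>n \<circ> m\<close>, as in a dihedral group.
\<close>
lemma funpow_reflect:
  assumes m: "\<And>x. m (m x) = x" and n: "\<And>x. n (n x) = x"
  shows "((n \<circ> m) ^^ k) (m (((n \<circ> m) ^^ k) x)) = m x"
proof (induction k arbitrary: x)
  case (Suc k)
  have "((n \<circ> m) ^^ Suc k) y = ((n \<circ> m) ^^ k) (n (m y))" for y
    by (simp add: funpow_Suc_right del: funpow.simps)
  moreover have "((n \<circ> m) ^^ Suc k) x = n (m (((n \<circ> m) ^^ k) x))"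
    by simp
  ultimately have "((n \<circ> m) ^^ Suc k) (m (((n \<circ> m) ^^ Suc k) x))
      = ((n \<circ> m) ^^ k) (n (m (m (n (m (((n \<circ> m) ^^ k) x))))))"
    by presburger
  then show ?case by (simp only: m n Suc)
qed simp

text \<open>
  Where the path reaches a fixed point of \<open>m\<close>, it turns round and returns to \<open>t\<close> at the same pace.
\<close>
lemma alternating_orbit_fixpoint_period:
  assumes m: "\<And>x. m (m x) = x" and n: "\<And>x. n (n x) = x" and t: "n t = t"
    and u: "u \<in> alternating_orbit m n t" "m u = u"
  obtains k where "u = ((n \<circ> m) ^^ k) t" "((n \<circ> m) ^^ Suc (2 * k)) t = t"
proof -
  obtain k where k: "u = ((n \<circ> m) ^^ k) t"
    using u m unfolding alternating_orbit_def by (metis (no_types, lifting) UnE rangeE)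
  have "((n \<circ> m) ^^ (2 * k)) t = ((n \<circ> m) ^^ k) (m (((n \<circ> m) ^^ k) t))"
    using u(2) k by (simp add: mult_2 funpow_add)
  also have "\<dots> = m t" by (rule funpow_reflect[OF m n])
  finally have "((n \<circ> m) ^^ Suc (2 * k)) t = t" by (simp add: m t)
  with k show thesis by (rule that)
qed

lemma funpow_fixed_mult: "(p ^^ a) t = t \<Longrightarrow> (p ^^ (a * b)) t = t"
  by (induction b) (auto simp: funpow_add)

text \<open>
  A path has only two ends, and one of them is \<open>t\<close>. Algebraically: if the powers \<open>i\<close> and \<open>j\<close> of
  \<open>n \<circ> m\<close> take \<open>t\<close> to fixed points of \<open>m\<close>, then \<open>t\<close> has the odd periods \<open>2 i + 1\<close> and \<open>2 j + 1\<close>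
  under \<open>n \<circ> m\<close>. Their difference \<open>2 (j - i)\<close> is a period as well, and then so is \<open>j - i\<close>, since it
  is congruent modulo \<open>2 (j - i)\<close> to \<open>(2 i + 1) (j - i)\<close>.
\<close>
lemma alternating_orbit_fixpoint_unique:
  assumes m: "\<And>x. m (m x) = x" and n: "\<And>x. n (n x) = x" and t: "n t = t"
    and u: "u \<in> alternating_orbit m n t" "m u = u"
    and v: "v \<in> alternating_orbit m n t" "m v = v"
  shows "u = v"
proof -
  let ?p = "n \<circ> m"
  have le: "(?p ^^ i) t = (?p ^^ j) t"
    if i: "(?p ^^ Suc (2 * i)) t = t" and j: "(?p ^^ Suc (2 * j)) t = t" and "i \<le> j" for i j
  proof -
    obtain e where e: "j = i + e" using \<open>i \<le> j\<close> le_Suc_ex by blast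
    have "(?p ^^ (2 * e)) t = (?p ^^ (2 * e)) ((?p ^^ Suc (2 * i)) t)"
      by (simp only: i)
    also have "\<dots> = (?p ^^ (2 * e + Suc (2 * i))) t"
      by (simp only: funpow_add o_apply)
    also have "2 * e + Suc (2 * i) = Suc (2 * j)" by (simp add: e)
    finally have two: "(?p ^^ (2 * e)) t = t" by (simp only: j)
    have "t = (?p ^^ (Suc (2 * i) * e)) t"
      by (rule funpow_fixed_mult[OF i, symmetric])
    also have "Suc (2 * i) * e = e + 2 * e * i" by simp
    also have "(?p ^^ (e + 2 * e * i)) t = (?p ^^ e) t"
      by (simp only: funpow_add o_apply funpow_fixed_mult[OF two])
    finally show ?thesis by (simp add: e funpow_add)
  qed
  obtain i where i: "u = (?p ^^ i) t" "(?p ^^ Suc (2 * i)) t = t"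
    using alternating_orbit_fixpoint_period[OF m n t u] by blast
  obtain j where j: "v = (?p ^^ j) t" "(?p ^^ Suc (2 * j)) t = t"
    using alternating_orbit_fixpoint_period[OF m n t v] by blast
  show ?thesis using le[OF i(2) j(2)] le[OF j(2) i(2)] i(1) j(1) by (metis nle_le)
qed

section \<open>Matchings as involutions\<close>

locale simple_graph =
  fixes V :: "'a set" and adj :: "'a \<Rightarrow> 'a \<Rightarrow> bool"
  assumes finite_V: "finite V"
    and adj_in_V: "adj x y \<Longrightarrow> x \<in> V"
    and adj_sym: "adj x y \<Longrightarrow> adj y x"
    and adj_irrefl: "\<not> adj x x"
begin

definition pairing :: "('a \<Rightarrow> 'a) \<Rightarrow> bool" where
  "pairing m \<longleftrightarrow> (\<forall>x. m (m x) = x) \<and> (\<forall>x. m x \<noteq> x \<longrightarrow> adj x (m x))"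

definition unmatched :: "('a \<Rightarrow> 'a) \<Rightarrow> 'a set" where
  "unmatched m = {x \<in> V. m x = x}"

text \<open>
  The involution of a maximum matching: fewest missed vertices amounts to most edges.
\<close>
definition optimal :: "('a \<Rightarrow> 'a) \<Rightarrow> bool" where
  "optimal m \<longleftrightarrow> pairing m \<and> (\<forall>n. pairing n \<longrightarrow> card (unmatched m) \<le> card (unmatched n))"

definition inessential :: "'a set" where
  "inessential = {x \<in> V. \<exists>m. optimal m \<and> m x = x}"

text \<open>
  Connectedness in the subgraph induced by the inessential vertices. As a reflexive closure it also
  relates every other element of the type to itself.
\<close>
definition linked :: "'a \<Rightarrow> 'a \<Rightarrow> bool" where
  "linked = (\<lambda>x y. x \<in> inessential \<and> y \<in> inessential \<and> adj x y)\<^sup>*\<^sup>*"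

definition isolated :: "'a set" where
  "isolated = {x \<in> inessential. \<forall>y \<in> inessential. \<not> adj x y}"

lemma pairing_involution: "pairing m \<Longrightarrow> m (m x) = x"
  and pairing_adj: "pairing m \<Longrightarrow> m x \<noteq> x \<Longrightarrow> adj x (m x)"
  by (auto simp: pairing_def)

lemma pairing_id: "pairing (\<lambda>x. x)" by (simp add: pairing_def)

lemma optimal_pairing: "optimal m \<Longrightarrow> pairing m" by (simp add: optimal_def)

lemma finite_unmatched: "finite (unmatched m)"
  unfolding unmatched_def using finite_V by simp

lemma pairing_override_on:
  assumes m: "pairing m" and n: "pairing n" and mK: "m ` K \<subseteq> K" and nK: "n ` K \<subseteq> K"
  shows "pairing (override_on m n K)"
proof -
  have "m x \<notin> K" if "x \<notin> K" for x
    using that mK pairing_involution[OF m] by (metis image_subset_iff)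
  then show ?thesis
    using m n nK unfolding pairing_def override_on_def by auto
qed

text \<open>
  Switching from \<open>m\<close> to \<open>n\<close> on \<open>K\<close> exchanges the vertices of \<open>K\<close> missed by \<open>m\<close> for those missed
  by \<open>n\<close>. The equation is written without subtraction.
\<close>
lemma card_unmatched_override_on:
  "card (unmatched (override_on m n K)) + card (unmatched m \<inter> K)
     = card (unmatched m) + card (unmatched n \<inter> K)"
proof -
  have "unmatched (override_on m n K) = (unmatched m - K) \<union> (unmatched n \<inter> K)"
    unfolding unmatched_def override_on_def by auto
  moreover have "card ((unmatched m - K) \<union> (unmatched n \<inter> K))
      = card (unmatched m - K) + card (unmatched n \<inter> K)"
    by (rule card_Un_disjoint) (auto simp: finite_unmatched)
  moreover have "card (unmatched m) = card (unmatched m - K) + card (unmatched m \<inter> K)"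
    using card_Diff_subset_Int[of "unmatched m" K] finite_unmatched[of m]
    by (simp add: card_mono)
  ultimately show ?thesis by simp
qed

lemma optimal_override_on:
  assumes m: "optimal m" and n: "pairing n" and mK: "m ` K \<subseteq> K" and nK: "n ` K \<subseteq> K"
    and le: "card (unmatched n \<inter> K) \<le> card (unmatched m \<inter> K)"
  shows "optimal (override_on m n K)"
  using m pairing_override_on[OF optimal_pairing[OF m] n mK nK]
    card_unmatched_override_on[of m n K] le
  unfolding optimal_def by fastforce

lemma optimal_card_unmatched_le:
  assumes m: "optimal m" and n: "pairing n" and mK: "m ` K \<subseteq> K" and nK: "n ` K \<subseteq> K"
  shows "card (unmatched m \<inter> K) \<le> card (unmatched n \<inter> K)"
  using m pairing_override_on[OF optimal_pairing[OF m] n mK nK]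
    card_unmatched_override_on[of m n K]
  unfolding optimal_def by fastforce

lemma ex_optimal: "\<exists>m. optimal m"
  using ex_has_least_nat[of pairing "\<lambda>x. x" "\<lambda>m. card (unmatched m)"] pairing_id
  unfolding optimal_def by blast

text \<open>
  On the orbit the two maximum matchings miss equally many vertices: if one of them missed fewer
  there, then switching the other one to it would improve the other one.
\<close>
lemma optimal_alternating_swap:
  assumes m: "optimal m" and n: "optimal n" and t: "n t = t"
  shows "optimal (override_on m n (alternating_orbit m n t))"
proof -
  note inv = pairing_involution[OF optimal_pairing[OF m]] pairing_involution[OF optimal_pairing[OF n]]
  note closed = alternating_orbit_closed[of m n, OF inv t]
  show ?thesis
    by (rule optimal_override_on[OF m optimal_pairing[OF n] closed])
       (rule optimal_card_unmatched_le[OF n optimal_pairing[OF m] closed(2) closed(1)])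
qed

text \<open>
  The sets of vertices that matchings can cover form the independent sets of a matroid, whose bases
  are the sets covered by maximum matchings. Here the extension to a basis is obtained from a maximum
  matching \<open>m\<close> that covers as much as possible of what \<open>f\<close> covers. If \<open>m\<close> missed a vertex \<open>j\<close> covered
  by \<open>f\<close>, it could be switched to \<open>f\<close> on the alternating path from \<open>j\<close>: this path has at most one
  end missed by \<open>f\<close>, while \<open>m\<close> misses \<open>j\<close>, so the result is still maximum. It covers everything on
  the path that \<open>f\<close> covers, among it \<open>j\<close>.
\<close>
lemma optimal_covers_pairing:
  assumes "pairing f"
  shows "\<exists>m. optimal m \<and> (\<forall>x. f x \<noteq> x \<longrightarrow> m x \<noteq> x)"
proof -
  let ?c = "\<lambda>m. card {x \<in> V. f x \<noteq> x \<and> m x \<noteq> x}"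
  obtain m where m: "optimal m" and greatest: "\<And>n. optimal n \<Longrightarrow> ?c n \<le> ?c m"
  proof -
    obtain m0 where m0: "optimal m0" using ex_optimal by blast
    have bound: "\<forall>n. optimal n \<longrightarrow> ?c n < Suc (card V)"
      using finite_V by (auto intro!: le_imp_less_Suc card_mono)
    show thesis using ex_has_greatest_nat[of optimal m0 ?c, OF m0 bound] that by blast
  qed
  have "m j \<noteq> j" if j: "f j \<noteq> j" for j
  proof
    assume mj: "m j = j"
    let ?K = "alternating_orbit f m j"
    note inv = pairing_involution[OF assms] pairing_involution[OF optimal_pairing[OF m]]
    note closed = alternating_orbit_closed[of f m, OF inv mj]
    have jV: "j \<in> V" using pairing_adj[OF assms j] by (rule adj_in_V)
    have jK: "j \<in> ?K" by (rule start_in_alternating_orbit)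
    have "card (unmatched f \<inter> ?K) \<le> Suc 0"
      using alternating_orbit_fixpoint_unique[of f m, OF inv mj]
      by (subst card_le_Suc0_iff_eq) (simp add: finite_unmatched, auto simp: unmatched_def)
    moreover have "Suc 0 \<le> card (unmatched m \<inter> ?K)"
      using jV jK mj finite_unmatched[of m]
      by (metis (mono_tags, lifting) IntI Suc_le_eq card_gt_0_iff empty_iff finite_Int mem_Collect_eq unmatched_def)
    ultimately have opt: "optimal (override_on m f ?K)"
      by (intro optimal_override_on[OF m assms closed(2,1)]) simp
    have "{x \<in> V. f x \<noteq> x \<and> m x \<noteq> x} \<subset> {x \<in> V. f x \<noteq> x \<and> override_on m f ?K x \<noteq> x}"
      using j jV jK mj by (auto simp: override_on_def)
    then have "?c m < ?c (override_on m f ?K)"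
      using finite_V by (intro psubset_card_mono) auto
    with greatest[OF opt] show False by simp
  qed
  with m show ?thesis by blast
qed

section \<open>Gallai's lemma\<close>

lemma adjacent_not_both_unmatched:
  assumes m: "optimal m" and "adj u v" "m u = u" "m v = v"
  shows False
proof -
  \<comment> \<open>Otherwise the edge \<open>uv\<close> could be added to \<open>m\<close>.\<close>
  let ?e = "\<lambda>x. if x = u then v else if x = v then u else x"
  have e: "pairing ?e"
    using \<open>adj u v\<close> adj_sym by (auto simp: pairing_def)
  have "u \<in> V" "v \<in> V" "u \<noteq> v" using \<open>adj u v\<close> adj_in_V adj_sym adj_irrefl by blast+
  have "card (unmatched m \<inter> {u, v}) \<le> card (unmatched ?e \<inter> {u, v})"
    using assms by (intro optimal_card_unmatched_le[OF m e]) auto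
  moreover have "unmatched m \<inter> {u, v} = {u, v}"
    using assms \<open>u \<in> V\<close> \<open>v \<in> V\<close> by (auto simp: unmatched_def)
  moreover have "unmatched ?e \<inter> {u, v} = {}"
    using \<open>u \<noteq> v\<close> by (auto simp: unmatched_def)
  ultimately show False using \<open>u \<noteq> v\<close> by simp
qed

text \<open>
  The relation ``equal or never missed together'' is transitive on the inessential vertices. Suppose
  that \<open>m\<close> misses \<open>u\<close> and \<open>v\<close>, and let \<open>t\<close> be an inessential vertex between them, which some maximum
  matching \<open>n\<close> misses. The alternating path from \<open>t\<close> has only one other end, so it avoids \<open>u\<close> or
  \<open>v\<close>. Switching \<open>m\<close> to \<open>n\<close> along it leaves that vertex missed together with \<open>t\<close>, which is
  excluded for the pairs \<open>u\<close>, \<open>t\<close> and \<open>t\<close>, \<open>v\<close>.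
\<close>
lemma linked_not_both_unmatched:
  assumes "linked u v" "optimal m" "m u = u" "m v = v"
  shows "u = v"
  using assms unfolding linked_def
proof (induction arbitrary: m rule: rtranclp_induct)
  case (step t v)
  show ?case
  proof (rule ccontr)
    assume "u \<noteq> v"
    have tv: "adj t v" "t \<in> inessential" using step.hyps by auto
    have mt: "m t \<noteq> t" using adjacent_not_both_unmatched[OF step.prems(1) tv(1)] step.prems by blast
    obtain n where n: "optimal n" "n t = t" using tv unfolding inessential_def by blast
    let ?K = "alternating_orbit m n t"
    let ?m' = "override_on m n ?K"
    note inv = pairing_involution[OF optimal_pairing[OF step.prems(1)]]
      pairing_involution[OF optimal_pairing[OF n(1)]]
    have opt: "optimal ?m'" by (rule optimal_alternating_swap[OF step.prems(1) n])
    have m't: "?m' t = t" using n start_in_alternating_orbit[of t m n] by (simp add: override_on_def)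
    \<comment> \<open>The path starts at \<open>t\<close>, and \<open>m\<close> misses at most one vertex on it.\<close>
    have "u \<notin> ?K \<or> v \<notin> ?K"
      using alternating_orbit_fixpoint_unique[of m n, OF inv n(2)] step.prems \<open>u \<noteq> v\<close> by blast
    then show False
    proof
      assume "u \<notin> ?K"
      then have "?m' u = u" using step.prems by (simp add: override_on_def)
      from step.IH[OF opt this m't] mt step.prems show False by simp
    next
      assume "v \<notin> ?K"
      then have "?m' v = v" using step.prems by (simp add: override_on_def)
      from adjacent_not_both_unmatched[OF opt tv(1) m't this] show False .
    qed
  qed
qed simp

section \<open>Blossoms\<close>

text \<open>
  The cycle is given by the sequence \<open>d 0, \<dots>, d (r - 1)\<close> of its vertices. The case \<open>r = 1\<close> is
  excluded because it would need a loop.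
\<close>
definition odd_cycle :: "nat \<Rightarrow> (nat \<Rightarrow> 'a) \<Rightarrow> bool" where
  "odd_cycle r d \<longleftrightarrow> odd r \<and> inj_on d {..<r} \<and> (\<forall>k<r. adj (d k) (d (Suc k mod r)))"

definition supports_perm :: "'a set \<Rightarrow> bool" where
  "supports_perm S \<longleftrightarrow> (\<exists>p. p permutes S \<and> (\<forall>x\<in>S. adj x (p x)))"

lemma odd_cycle_ge_3:
  assumes "odd_cycle r d" shows "3 \<le> r"
proof -
  have "r \<noteq> 1" using assms adj_irrefl unfolding odd_cycle_def by auto
  moreover have "odd r" using assms unfolding odd_cycle_def by simp
  ultimately show ?thesis by presburger
qed

lemma odd_cycle_rotate:
  assumes d: "odd_cycle r d"
  shows "odd_cycle r (\<lambda>k. d ((k + a) mod r))"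
    and "(\<lambda>k. d ((k + a) mod r)) ` {..<r} = d ` {..<r}"
proof -
  have r: "0 < r" using odd_cycle_ge_3[OF d] by simp
  have inj: "inj_on (\<lambda>k. (k + a) mod r) {..<r}"
  proof (rule inj_onI)
    fix k l assume "k \<in> {..<r}" "l \<in> {..<r}" "(k + a) mod r = (l + a) mod r"
    then have "[k = l] (mod r)"
      using cong_add_rcancel_nat[of k a l r] by (simp add: cong_def)
    with \<open>k \<in> {..<r}\<close> \<open>l \<in> {..<r}\<close> show "k = l" by (simp add: cong_def)
  qed
  have sub: "(\<lambda>k. (k + a) mod r) ` {..<r} \<subseteq> {..<r}" using r by auto
  have img: "(\<lambda>k. (k + a) mod r) ` {..<r} = {..<r}"
    by (rule endo_inj_surj[OF _ sub inj]) simp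
  have "inj_on (d \<circ> (\<lambda>k. (k + a) mod r)) {..<r}"
    using d img inj unfolding odd_cycle_def by (intro comp_inj_on) auto
  moreover have "adj (d ((k + a) mod r)) (d ((Suc k mod r + a) mod r))" if "k < r" for k
  proof -
    have "(Suc k mod r + a) mod r = Suc ((k + a) mod r) mod r"
      by (simp add: mod_simps)
    then show ?thesis using d r unfolding odd_cycle_def by simp
  qed
  ultimately show "odd_cycle r (\<lambda>k. d ((k + a) mod r))"
    using d unfolding odd_cycle_def by (simp add: o_def)
  show "(\<lambda>k. d ((k + a) mod r)) ` {..<r} = d ` {..<r}"
    using img by (metis image_image)
qed

lemma odd_cycle_supports_perm:
  assumes d: "odd_cycle r d"
  shows "supports_perm (d ` {..<r})"
proof -
  let ?O = "d ` {..<r}"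
  let ?i = "the_inv_into {..<r} d"
  let ?p = "\<lambda>x. if x \<in> ?O then d (Suc (?i x) mod r) else x"
  have r: "0 < r" using odd_cycle_ge_3[OF d] by simp
  have inj: "inj_on d {..<r}" using d by (simp add: odd_cycle_def)
  have i: "?i (d k) = k" if "k < r" for k using inj that by (simp add: the_inv_into_f_f)
  have p: "?p (d k) = d (Suc k mod r)" if "k < r" for k using i[OF that] that by auto
  have "?p ` ?O = (\<lambda>k. d ((k + 1) mod r)) ` {..<r}"
    unfolding image_image by (intro image_cong refl) (use p in force)
  also have "\<dots> = ?O" by (rule odd_cycle_rotate(2)[OF d])
  finally have surj: "?p ` ?O = ?O" .
  have "?p permutes ?O"
  proof (rule bij_imp_permutes)
    show "bij_betw ?p ?O ?O"
      using surj by (intro bij_betw_imageI finite_surj_inj[of ?O ?p]) auto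
  qed auto
  moreover have "\<forall>x\<in>?O. adj x (?p x)"
    using d p unfolding odd_cycle_def by force
  ultimately show ?thesis unfolding supports_perm_def by blast
qed

text \<open>
  Number the cycle so that \<open>w\<close> comes first; the remaining vertices, even in number and consecutive,
  are paired off in their order.
\<close>
lemma odd_cycle_near_perfect_pairing:
  assumes d: "odd_cycle r d" and w: "w \<in> d ` {..<r}"
  shows "\<exists>f. pairing f \<and> f ` (d ` {..<r}) \<subseteq> d ` {..<r} \<and> unmatched f \<inter> d ` {..<r} = {w}"
proof -
  obtain a where a: "w = d a" "a < r" using w by blast
  define e where "e = (\<lambda>k. d ((k + a) mod r))"
  have e: "odd_cycle r e" "e ` {..<r} = d ` {..<r}" "e 0 = w"
    unfolding e_def using odd_cycle_rotate[OF d] a by auto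
  have r: "0 < r" "odd r" using odd_cycle_ge_3[OF d] d by (auto simp: odd_cycle_def)
  let ?O = "e ` {..<r}"
  define h :: "nat \<Rightarrow> nat" where "h k = (if k = 0 then 0 else if odd k then k + 1 else k - 1)" for k
  have inj: "inj_on e {..<r}" using e by (simp add: odd_cycle_def)
  let ?i = "the_inv_into {..<r} e"
  \<comment> \<open>\<open>h\<close> pairs the places \<open>1, 2\<close>, then \<open>3, 4\<close>, and so on; the last one, \<open>r - 1\<close>, is even.\<close>
  let ?f = "\<lambda>x. if x \<in> ?O then e (h (?i x)) else x"
  have hr: "h k < r" if "k < r" for k
  proof (cases "odd k")
    case True
    then have "k + 1 \<noteq> r" using r by auto
    with True that show ?thesis by (simp add: h_def)
  next
    case False
    then show ?thesis using that by (auto simp: h_def)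
  qed
  have hh: "h (h k) = k" for k
    by (cases k) (auto simp: h_def elim: oddE)
  have f: "?f (e k) = e (h k)" if "k < r" for k
    using that inj by (simp add: the_inv_into_f_f)
  have step: "adj (e k) (e (Suc k))" if "Suc k < r" for k
    using e(1) that unfolding odd_cycle_def by (metis Suc_lessD mod_less)
  have adj: "adj (e k) (e (h k))" if k: "k < r" "k \<noteq> 0" for k
  proof (cases "odd k")
    case True
    then have "h k = Suc k" using k by (simp add: h_def)
    then show ?thesis using step hr[OF k(1)] by simp
  next
    case False
    then obtain l where l: "k = Suc l" "h k = l" using k(2) by (cases k) (auto simp: h_def)
    then show ?thesis using step[of l] k adj_sym by simp
  qed
  have ffx: "?f (?f x) = x" for x
  proof (cases "x \<in> ?O")
    case True
    then obtain k where k: "x = e k" "k < r" by blast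
    show ?thesis unfolding k(1) f[OF k(2)] f[OF hr[OF k(2)]] hh ..
  qed simp
  have "?f x \<noteq> x \<longrightarrow> adj x (?f x)" for x
  proof (cases "x \<in> ?O")
    case True
    then obtain k where k: "x = e k" "k < r" by blast
    show ?thesis unfolding k(1) f[OF k(2)] using adj[OF k(2)] by (cases "k = 0") (auto simp: h_def)
  qed simp
  then have "pairing ?f" using ffx by (simp add: pairing_def)
  moreover have "?f ` ?O \<subseteq> ?O" using f hr by force
  moreover have "unmatched ?f \<inter> ?O = {e 0}"
  proof -
    have "?f (e k) = e k \<longleftrightarrow> k = 0" if "k < r" for k
      using f[OF that] adj[OF that] adj_irrefl by (cases "k = 0") (auto simp: h_def)
    moreover have "e k \<in> V" if "k < r" for k
      using e(1) that adj_in_V unfolding odd_cycle_def by blast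
    ultimately show ?thesis using r unfolding unmatched_def by (auto split del: if_split)
  qed
  ultimately show ?thesis using e by (metis (no_types, lifting))
qed

text \<open>
  An alternating path from \<open>t\<close> to \<open>u\<close> has an even number of edges, as its first edge belongs to \<open>m\<close>
  and its last one to \<open>n\<close>; the edge \<open>ut\<close> closes it to an odd cycle. In the proof \<open>c k\<close> is
  \<open>(n \<circ> m) ^^ k\<close> applied to \<open>t\<close>, which has an odd least period \<open>r = 2 i + 1\<close>; on the indices modulo \<open>r\<close>
  the involutions \<open>m\<close> and \<open>n\<close> act as the reflections \<open>k \<mapsto> - k - 1\<close> and \<open>k \<mapsto> - k\<close>. The
  sequence \<open>d\<close> lists the same vertices in the order of the path.
\<close>
lemma alternating_orbit_odd_cycle:
  assumes m: "pairing m" and n: "pairing n" and t: "n t = t"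
    and u: "u \<in> alternating_orbit m n t" "m u = u" and ut: "adj u t"
  shows "\<exists>r d. odd_cycle r d \<and> u \<in> d ` {..<r} \<and> m ` (d ` {..<r}) \<subseteq> d ` {..<r}"
proof -
  note inv = pairing_involution[OF m] pairing_involution[OF n]
  let ?p = "n \<circ> m"
  define c where "c k = (?p ^^ k) t" for k
  obtain k0 where k0: "(?p ^^ Suc (2 * k0)) t = t"
    using alternating_orbit_fixpoint_period[of m n, OF inv t u] by blast
  define r where "r = (LEAST r. 0 < r \<and> (?p ^^ r) t = t)"
  have r: "0 < r" "(?p ^^ r) t = t"
    using LeastI[of "\<lambda>r. 0 < r \<and> (?p ^^ r) t = t", OF conjI[OF zero_less_Suc k0]]
    unfolding r_def by auto
  have least: "(?p ^^ l) t \<noteq> t" if "0 < l" "l < r" for l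
    using not_less_Least[of l "\<lambda>r. 0 < r \<and> (?p ^^ r) t = t"] that unfolding r_def by blast
  have c_inj: "inj_on c {..<r}"
    using inj_on_funpow_least[OF r(2) least] unfolding c_def atLeast0LessThan .
  have "(?p ^^ (Suc (2 * k0) mod r)) t = t"
    using funpow_mod_eq[OF r(2), of "Suc (2 * k0)"] k0 by simp
  then have "Suc (2 * k0) mod r = 0"
    using least[of "Suc (2 * k0) mod r"] r(1) by (metis mod_less_divisor neq0_conv)
  then have "r dvd Suc (2 * k0)" by (simp add: mod_eq_0_iff_dvd)
  then have "odd r" by (metis dvd_trans even_Suc even_mult_iff even_numeral)
  then obtain i where i: "r = Suc (2 * i)" by (auto elim: oddE)
  have p_inj: "(?p ^^ k) x = (?p ^^ k) y \<Longrightarrow> x = y" for k x y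
  proof (induction k)
    case (Suc k)
    then show ?case using inv by simp metis
  qed simp
  have mc: "m (c k) = c (2 * i - k)" if "k \<le> 2 * i" for k
  proof (rule p_inj)
    have "(?p ^^ Suc k) (m (c k)) = ?p (m t)"
      using funpow_reflect[of m n k t, OF inv] unfolding c_def by simp
    also have "\<dots> = t" using inv t by simp
    also have "\<dots> = (?p ^^ (Suc k + (2 * i - k))) t" using r(2) i that by simp
    also have "\<dots> = (?p ^^ Suc k) (c (2 * i - k))" unfolding c_def funpow_add by simp
    finally show "(?p ^^ Suc k) (m (c k)) = (?p ^^ Suc k) (c (2 * i - k))" .
  qed
  have c_eq: "c k = c l \<longleftrightarrow> k = l" if "k \<le> 2 * i" "l \<le> 2 * i" for k l
    using inj_onD[OF c_inj, of k l] that i by auto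
  have ci: "c k \<in> alternating_orbit m n t" for k
    unfolding c_def alternating_orbit_def by blast
  have "m (c i) = c i" using mc[of i] by simp
  then have u_c: "u = c i"
    using alternating_orbit_fixpoint_unique[of m n, OF inv t u ci] by simp
  define d where "d k = (if even k then c (k div 2) else c (2 * i - k div 2))" for k
  have step: "adj (d k) (d (Suc k))" if "Suc k < r" for k
  proof (cases "even k")
    case True
    then obtain a where a: "k = 2 * a" by blast
    with that i have ai: "a < i" by simp
    have "d (Suc k) = m (c a)" "d k = c a" using a ai by (simp_all add: d_def mc)
    moreover have "m (c a) \<noteq> c a" using mc[of a] c_eq[of "2 * i - a" a] ai by simp
    ultimately show ?thesis using pairing_adj[OF m, of "c a"] by simp
  next
    case False
    then obtain a where a: "k = Suc (2 * a)" by (auto elim: oddE)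
    with that i have ai: "a < i" by simp
    have "d (Suc k) = c (Suc a)" "d k = m (c a)" using a ai by (simp_all add: d_def mc)
    moreover have "c (Suc a) = n (m (c a))" by (simp add: c_def)
    moreover have "c (Suc a) \<noteq> c (2 * i - a)"
    proof -
      have "Suc a \<noteq> 2 * i - a" using ai by presburger
      then show ?thesis using c_eq[of "Suc a" "2 * i - a"] ai by simp
    qed
    ultimately show ?thesis using pairing_adj[OF n, of "m (c a)"] mc[of a] ai by simp
  qed
  have "adj (d k) (d (Suc k mod r))" if "k < r" for k
  proof (cases "Suc k < r")
    case False
    then have "Suc k = r" using that by simp
    then have "k = 2 * i" "Suc k mod r = 0" using i by auto
    then show ?thesis using ut u_c by (simp add: d_def c_def)
  qed (use step in simp)
  moreover have "inj_on d {..<r}"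
  proof (rule inj_onI)
    fix k l assume kl: "k \<in> {..<r}" "l \<in> {..<r}" "d k = d l"
    \<comment> \<open>\<open>d\<close> visits the vertices of index \<open>0, \<dots>, i\<close> at its even and those of index \<open>i + 1, \<dots>, 2 i\<close>
      at its odd places, so \<open>h\<close> can recover the place from the index.\<close>
    define g where "g k = (if even k then k div 2 else 2 * i - k div 2)" for k :: nat
    define h where "h y = (if y \<le> i then 2 * y else Suc (2 * (2 * i - y)))" for y
    have hg: "h (g k) = k" if "k < r" for k
    proof (cases "even k")
      case True
      then obtain a where "k = 2 * a" by blast
      then show ?thesis using that i by (simp add: g_def h_def)
    next
      case False
      then obtain a where "k = Suc (2 * a)" by (auto elim: oddE)
      then show ?thesis using that i by (simp add: g_def h_def)
    qed
    have "d x = c (g x)" for x by (simp add: d_def g_def)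
    moreover have "g k \<le> 2 * i" "g l \<le> 2 * i" using kl i by (auto simp: g_def)
    ultimately have "g k = g l" using kl c_eq by simp
    then show "k = l" using kl hg by (metis lessThan_iff)
  qed
  ultimately have cyc: "odd_cycle r d" using \<open>odd r\<close> by (simp add: odd_cycle_def)
  have "d ` {..<r} \<subseteq> c ` {..<r}" using i by (auto simp: d_def)
  moreover have "card (d ` {..<r}) = card (c ` {..<r})"
    using cyc c_inj by (simp add: card_image odd_cycle_def)
  ultimately have O: "d ` {..<r} = c ` {..<r}" by (intro card_subset_eq) auto
  have "u \<in> c ` {..<r}" using u_c i by auto
  moreover have "m ` (c ` {..<r}) \<subseteq> c ` {..<r}" using mc i by auto
  ultimately show ?thesis using cyc O by metis
qed

lemma supports_perm_Un:
  assumes "supports_perm S" "supports_perm T" "S \<inter> T = {}"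
  shows "supports_perm (S \<union> T)"
proof -
  obtain p q where p: "p permutes S" "\<forall>x\<in>S. adj x (p x)" and q: "q permutes T" "\<forall>x\<in>T. adj x (q x)"
    using assms unfolding supports_perm_def by blast
  have "(p \<circ> q) permutes (S \<union> T)"
    using p q by (intro permutes_compose) (auto elim: permutes_subset)
  moreover have "adj x ((p \<circ> q) x)" if "x \<in> S \<union> T" for x
  proof (cases "x \<in> T")
    case True
    then have "q x \<in> T" using q by (simp add: permutes_in_image)
    then have "q x \<notin> S" using assms(3) by blast
    then have "p (q x) = q x" using p by (simp add: permutes_not_in)
    then show ?thesis using q True by simp
  next
    case False
    then have "q x = x" using q by (auto simp: permutes_not_in)
    then show ?thesis using p that False by simp
  qed
  ultimately show ?thesis unfolding supports_perm_def by blast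
qed

lemma supports_perm_UN:
  assumes "finite J" "\<And>j. j \<in> J \<Longrightarrow> supports_perm (S j)"
    "\<And>i j. i \<in> J \<Longrightarrow> j \<in> J \<Longrightarrow> i \<noteq> j \<Longrightarrow> S i \<inter> S j = {}"
  shows "supports_perm (\<Union>j\<in>J. S j)"
  using assms
proof (induction J)
  case empty
  show ?case using permutes_id unfolding supports_perm_def by fastforce
next
  case (insert i J)
  then have "supports_perm (S i \<union> (\<Union>j\<in>J. S j))" by (intro supports_perm_Un) auto
  then show ?case by simp
qed

lemma supports_perm_pairing:
  assumes m: "pairing m" and "m ` S \<subseteq> S" "\<And>x. x \<in> S \<Longrightarrow> m x \<noteq> x"
  shows "supports_perm S"
proof -
  let ?p = "\<lambda>x. if x \<in> S then m x else x"
  have "?p permutes S"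
    using assms(2) pairing_involution[OF m]
    by (intro bij_imp_permutes bij_betwI[where g = ?p]) auto
  then show ?thesis unfolding supports_perm_def using assms(3) pairing_adj[OF m] by auto
qed

lemma linked_inessential: "linked x y \<Longrightarrow> x \<in> inessential \<Longrightarrow> y \<in> inessential"
  unfolding linked_def by (induction rule: rtranclp_induct) auto

lemma linked_sym: "linked x y \<Longrightarrow> linked y x"
  unfolding linked_def
  by (rule sympD[OF symp_rtranclp]) (auto simp: symp_def intro: adj_sym)

lemma linked_trans: "linked x y \<Longrightarrow> linked y z \<Longrightarrow> linked x z"
  unfolding linked_def by (rule rtranclp_trans)

lemma linked_adj: "x \<in> inessential \<Longrightarrow> y \<in> inessential \<Longrightarrow> adj x y \<Longrightarrow> linked x y"
  unfolding linked_def by blast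

lemma unmatched_inessential: "optimal m \<Longrightarrow> unmatched m \<subseteq> inessential"
  unfolding inessential_def unmatched_def by blast

text \<open>
  \<open>B\<close> is the odd cycle formed by the edge from \<open>u\<close> to an inessential neighbour \<open>t\<close> and the alternating
  path from \<open>t\<close> to \<open>u\<close>. It lies in the component of \<open>u\<close>, because each of its vertices \<open>w\<close> is
  inessential: the pairing of the cycle without \<open>w\<close> can replace \<open>m\<close> on the cycle.
\<close>
lemma blossom_at_unmatched:
  assumes m: "optimal m" and u: "u \<in> unmatched m - isolated"
  shows "\<exists>B. u \<in> B \<and> m ` B \<subseteq> B \<and> supports_perm B \<and> 3 \<le> card B \<and> (\<forall>x\<in>B. linked u x)"
proof -
  have mu: "m u = u" and uD: "u \<in> inessential" using u unmatched_inessential[OF m] by (auto simp: unmatched_def)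
  then obtain t where t: "t \<in> inessential" "adj u t" using u unfolding isolated_def by blast
  obtain n where n: "optimal n" "n t = t" using t unfolding inessential_def by blast
  note pm = optimal_pairing[OF m] and pn = optimal_pairing[OF n(1)]
  have "u \<in> alternating_orbit m n t"
  proof (rule ccontr)
    assume "u \<notin> alternating_orbit m n t"
    then have "override_on m n (alternating_orbit m n t) u = u" using mu by simp
    moreover have "override_on m n (alternating_orbit m n t) t = t"
      using n start_in_alternating_orbit[of t m n] by simp
    ultimately show False
      using adjacent_not_both_unmatched[OF optimal_alternating_swap[OF m n] t(2)] by blast
  qed
  from alternating_orbit_odd_cycle[OF pm pn n(2) this mu t(2)]
  obtain r d where d: "odd_cycle r d" and ud: "u \<in> d ` {..<r}" and md: "m ` (d ` {..<r}) \<subseteq> d ` {..<r}"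
    by blast
  let ?B = "d ` {..<r}"
  have u1: "Suc 0 \<le> card (unmatched m \<inter> ?B)"
    using u ud by (auto simp: Suc_le_eq card_gt_0_iff finite_unmatched)
  have B: "w \<in> inessential" if w: "w \<in> ?B" for w
  proof -
    obtain f where f: "pairing f" "f ` ?B \<subseteq> ?B" "unmatched f \<inter> ?B = {w}"
      using odd_cycle_near_perfect_pairing[OF d w] by blast
    have "optimal (override_on m f ?B)"
      by (rule optimal_override_on[OF m f(1) md f(2)]) (use f u1 in simp)
    moreover have "override_on m f ?B w = w" "w \<in> V" using f(3) w by (auto simp: unmatched_def)
    ultimately show ?thesis unfolding inessential_def by blast
  qed
  have "linked (d 0) (d k)" if "k < r" for k
    using that
  proof (induction k)
    case 0
    then show ?case by (simp add: linked_def)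
  next
    case (Suc k)
    then have "adj (d k) (d (Suc k))" using d unfolding odd_cycle_def by (metis Suc_lessD mod_less)
    then show ?case using Suc linked_adj[of "d k" "d (Suc k)"] B linked_trans by simp
  qed
  then have "\<forall>x\<in>?B. linked u x" using ud linked_sym linked_trans by blast
  moreover have "card ?B = r" using d by (simp add: card_image odd_cycle_def)
  ultimately show ?thesis
    using ud md odd_cycle_supports_perm[OF d] odd_cycle_ge_3[OF d] by (intro exI[of _ ?B]) auto
qed

section \<open>Permutations along edges\<close>

text \<open>
  These are the permutations whose terms in the permanental polynomial do not vanish. The vertices
  that they move form a union of disjoint edges and cycles.
\<close>
definition edge_permutation :: "('a \<Rightarrow> 'a) \<Rightarrow> bool" where
  "edge_permutation p \<longleftrightarrow> p permutes V \<and> (\<forall>x. p x \<noteq> x \<longrightarrow> adj x (p x))"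

text \<open>
  The moved vertices split into the blossoms \<open>?W\<close>, which are rotated, and the rest \<open>?R\<close> of what \<open>m\<close>
  covers, on which \<open>m\<close> itself is used. Blossoms lie in components, so two of them are disjoint by
  Gallai's lemma.
\<close>
lemma edge_permutation_of_optimal:
  assumes m: "optimal m"
  shows "\<exists>p. edge_permutation p \<and> unmatched p = unmatched m \<inter> isolated"
proof -
  let ?J = "unmatched m - isolated"
  obtain B where B: "\<And>u. u \<in> ?J \<Longrightarrow> u \<in> B u \<and> m ` B u \<subseteq> B u \<and> supports_perm (B u) \<and> (\<forall>x\<in>B u. linked u x)"
    using blossom_at_unmatched[OF m] by metis
  let ?W = "\<Union>u\<in>?J. B u"
  let ?R = "V - unmatched m - ?W"
  have "B u \<inter> B v = {}" if "u \<in> ?J" "v \<in> ?J" "u \<noteq> v" for u v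
  proof -
    have False if "x \<in> B u" "x \<in> B v" for x
    proof -
      have "linked u v" using B[OF \<open>u \<in> ?J\<close>] B[OF \<open>v \<in> ?J\<close>] that linked_sym[of v x] linked_trans[of u x v] by simp
      moreover have "m u = u" "m v = v" using \<open>u \<in> ?J\<close> \<open>v \<in> ?J\<close> by (simp_all add: unmatched_def)
      ultimately show False using linked_not_both_unmatched[OF _ m] \<open>u \<noteq> v\<close> by blast
    qed
    then show ?thesis by blast
  qed
  then have W: "supports_perm ?W"
    using B by (intro supports_perm_UN) (auto simp: finite_unmatched)
  have inv: "m (m x) = x" for x by (rule pairing_involution[OF optimal_pairing[OF m]])
  have WV: "?W \<subseteq> V" using W adj_in_V unfolding supports_perm_def by blast
  have mW: "m ` ?W \<subseteq> ?W" using B by blast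
  have "m x \<in> ?R" if x: "x \<in> ?R" for x
  proof -
    have mx: "m x \<noteq> x" using x by (auto simp: unmatched_def)
    have "m x \<in> V" using pairing_adj[OF optimal_pairing[OF m] mx] adj_in_V adj_sym by blast
    moreover have "m x \<notin> unmatched m" using mx inv by (auto simp: unmatched_def)
    moreover have "m x \<notin> ?W"
    proof
      assume "m x \<in> ?W"
      then have "m (m x) \<in> ?W" using mW by blast
      then show False using x inv by simp
    qed
    ultimately show ?thesis by blast
  qed
  then have R: "supports_perm ?R"
    by (intro supports_perm_pairing[OF optimal_pairing[OF m]]) (auto simp: unmatched_def)
  have "?W \<inter> unmatched m \<inter> isolated = {}"
  proof -
    have False if x: "x \<in> ?W" "x \<in> unmatched m" "x \<in> isolated" for x
    proof -
      obtain u where u: "u \<in> ?J" "x \<in> B u" using x by blast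
      have "linked u x" using B[OF u(1)] u(2) by simp
      moreover have "m u = u" "m x = x" using u(1) x(2) by (simp_all add: unmatched_def)
      ultimately have "u = x" using linked_not_both_unmatched[OF _ m] by blast
      then show False using u x by blast
    qed
    then show ?thesis by blast
  qed
  moreover have "?J \<subseteq> ?W" using B by blast
  moreover have "unmatched m \<subseteq> V" by (auto simp: unmatched_def)
  ultimately have eq: "?W \<union> ?R = V - unmatched m \<inter> isolated" using WV by blast
  have "supports_perm (?W \<union> ?R)" by (rule supports_perm_Un[OF W R]) blast
  then obtain p where p: "p permutes (V - unmatched m \<inter> isolated)"
    "\<forall>x\<in>V - unmatched m \<inter> isolated. adj x (p x)"
    unfolding eq supports_perm_def by blast
  have "p x = x \<longleftrightarrow> x \<notin> V - unmatched m \<inter> isolated" for x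
    using p adj_irrefl by (metis permutes_not_in)
  then have "unmatched p = unmatched m \<inter> isolated" "\<forall>x. p x \<noteq> x \<longrightarrow> adj x (p x)"
    using p by (auto simp: unmatched_def)
  moreover have "p permutes V" using p(1) by (rule permutes_subset) blast
  ultimately show ?thesis unfolding edge_permutation_def by blast
qed

text \<open>
  Isolated vertices of \<open>G[D(G)]\<close> have no inessential neighbours. So \<open>p\<close> maps the ones that it
  moves, \<open>?J\<close>, out of \<open>?J\<close>, and joining each to its image is a matching.
\<close>
lemma edge_permutation_isolated_covered:
  assumes p: "edge_permutation p"
  shows "\<exists>m. optimal m \<and> unmatched m \<inter> isolated \<subseteq> unmatched p"
proof -
  let ?J = "isolated - unmatched p"
  have perm: "p permutes V" and pa: "\<And>x. p x \<noteq> x \<Longrightarrow> adj x (p x)" using p by (auto simp: edge_permutation_def)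
  have iV: "isolated \<subseteq> V" unfolding isolated_def inessential_def by blast
  have J: "adj x (p x)" if "x \<in> ?J" for x
    using that pa iV by (auto simp: unmatched_def)
  have pJ: "p x \<notin> ?J" if "x \<in> ?J" for x
    using J[OF that] that by (auto simp: isolated_def)
  have inj: "inv p (p x) = x" "p (inv p x) = x" for x
    using permutes_inverses[OF perm] by auto
  define f where "f x = (if x \<in> ?J then p x else if inv p x \<in> ?J then inv p x else x)" for x
  have "f (f x) = x" for x
  proof -
    consider "x \<in> ?J" | "x \<notin> ?J" "inv p x \<in> ?J" | "x \<notin> ?J" "inv p x \<notin> ?J" by blast
    then show ?thesis
      by cases (use pJ inj in \<open>simp_all add: f_def del: Diff_iff\<close>)
  qed
  moreover have "adj x (f x)" if "f x \<noteq> x" for x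
    using that J[of x] adj_sym[OF J[of "inv p x"]] inj(2)[of x] by (simp add: f_def split: if_splits del: Diff_iff)
  ultimately have f: "pairing f" by (simp add: pairing_def)
  obtain m where m: "optimal m" "\<forall>x. f x \<noteq> x \<longrightarrow> m x \<noteq> x"
    using optimal_covers_pairing[OF f] by blast
  have "x \<notin> unmatched m" if "x \<in> ?J" for x
  proof -
    have "f x \<noteq> x" using J[OF that] adj_irrefl[of x] that by (auto simp: f_def)
    then show ?thesis using m by (auto simp: unmatched_def)
  qed
  then show ?thesis using m by blast
qed

lemma least_fixed_edge_permutation:
  assumes m: "optimal m"
    and most: "\<And>n. optimal n \<Longrightarrow> card (unmatched m \<inter> isolated) \<le> card (unmatched n \<inter> isolated)"
  shows "\<exists>p. edge_permutation p \<and> card (unmatched p) = card (unmatched m \<inter> isolated)"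
    and "edge_permutation p \<Longrightarrow> card (unmatched m \<inter> isolated) \<le> card (unmatched p)"
proof -
  show "\<exists>p. edge_permutation p \<and> card (unmatched p) = card (unmatched m \<inter> isolated)"
    using edge_permutation_of_optimal[OF m] by metis
  assume "edge_permutation p"
  then obtain n where n: "optimal n" "unmatched n \<inter> isolated \<subseteq> unmatched p"
    using edge_permutation_isolated_covered by blast
  have "card (unmatched n \<inter> isolated) \<le> card (unmatched p)"
    by (rule card_mono[OF finite_unmatched n(2)])
  then show "card (unmatched m \<inter> isolated) \<le> card (unmatched p)" using most[OF n(1)] by simp
qed

section \<open>Counting the missed components\<close>

text \<open>
  By Gallai's lemma a missed vertex is the only one in its component, so it can stand for it. It is
  isolated exactly when its component has fewer than three vertices, since a component that is not a
  singleton contains a blossom at its missed vertex.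
\<close>
lemma card_big_components_missed:
  assumes m: "optimal m"
  shows "card {S. \<exists>u\<in>inessential. S = {v. linked u v} \<and> 3 \<le> card S \<and> card (S \<inter> unmatched m) = 1}
      = card (unmatched m - isolated)"
proof -
  let ?K = "\<lambda>u. {v. linked u v}"
  let ?J = "unmatched m - isolated"
  have refl: "linked u u" for u by (simp add: linked_def)
  have class_eq: "?K u = ?K v" if "linked u v" for u v
    using that linked_sym linked_trans by blast
  have gallai: "u = v" if "linked u v" "u \<in> unmatched m" "v \<in> unmatched m" for u v
    using linked_not_both_unmatched[OF that(1) m] that by (auto simp: unmatched_def)
  have iso: "?K u = {u}" if "u \<in> isolated" for u
  proof -
    have "v = u" if "linked u v" for v
      using that \<open>u \<in> isolated\<close> unfolding linked_def isolated_def
      by (induction rule: rtranclp_induct) auto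
    then show ?thesis using refl by blast
  qed
  have single: "?K u \<inter> unmatched m = {u}" if "u \<in> unmatched m" for u
    using gallai that refl by blast
  have "{S. \<exists>u\<in>inessential. S = ?K u \<and> 3 \<le> card S \<and> card (S \<inter> unmatched m) = 1} = ?K ` ?J"
  proof (intro equalityI subsetI)
    fix S assume "S \<in> {S. \<exists>u\<in>inessential. S = ?K u \<and> 3 \<le> card S \<and> card (S \<inter> unmatched m) = 1}"
    then obtain w where w: "S = ?K w" "3 \<le> card S" "card (S \<inter> unmatched m) = 1" by blast
    then obtain u where u: "u \<in> S" "u \<in> unmatched m" by (metis IntE card_1_singletonE insertI1)
    then have S: "S = ?K u" using w(1) class_eq by blast
    then have "u \<notin> isolated" using iso[of u] w(2) by auto
    then show "S \<in> ?K ` ?J" using S u by blast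
  next
    fix S assume "S \<in> ?K ` ?J"
    then obtain u where u: "u \<in> ?J" "S = ?K u" by blast
    have uD: "u \<in> inessential" using u unmatched_inessential[OF m] by blast
    obtain B where B: "3 \<le> card B" "\<forall>x\<in>B. linked u x" using blossom_at_unmatched[OF m u(1)] by blast
    have "?K u \<subseteq> inessential" using linked_inessential uD by blast
    also have "inessential \<subseteq> V" by (auto simp: inessential_def)
    finally have "finite (?K u)" using finite_V finite_subset by blast
    then have "3 \<le> card (?K u)" using B card_mono[of "?K u" B] by fastforce
    moreover have "card (?K u \<inter> unmatched m) = 1" using single u by simp
    ultimately show "S \<in> {S. \<exists>u\<in>inessential. S = ?K u \<and> 3 \<le> card S \<and> card (S \<inter> unmatched m) = 1}"
      using uD u by blast
  qed
  moreover have "inj_on ?K ?J"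
    using gallai refl by (intro inj_onI) blast
  ultimately show ?thesis by (simp add: card_image)
qed

end

section \<open>The permanental polynomial\<close>

lemma simple_graph_of_graph:
  assumes "Digraph.graph G"
  shows "simple_graph (verts G) (\<lambda>u v. u \<rightarrow>\<^bsub>G\<^esub> v)"
proof -
  interpret G: Digraph.graph G by fact
  show ?thesis
    using G.adj_not_same by unfold_locales (auto intro: G.adj_in_verts arcs_ends_symmetric[OF G.sym_arcs])
qed

text \<open>
  As \<open>G\<close> has no loops, the factor of a fixed vertex is \<open>x\<close>, and the factor of a moved vertex is
  \<open>-1\<close> or \<open>0\<close>. The sign thus depends only on the number of fixed points.
\<close>
lemma coeff_permanental_poly:
  assumes "Digraph.graph G"
  shows "coeff (permanental_poly G) k
    = (-1) ^ (card (verts G) - k) *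
      real (card {p. simple_graph.edge_permutation (verts G) (\<lambda>u v. u \<rightarrow>\<^bsub>G\<^esub> v) p
        \<and> card (simple_graph.unmatched (verts G) p) = k})"
proof -
  interpret simple_graph "verts G" "\<lambda>u v. u \<rightarrow>\<^bsub>G\<^esub> v"
    by (rule simple_graph_of_graph[OF assms])
  let ?V = "verts G"
  let ?t = "\<lambda>p. \<Prod>i\<in>?V. (if i = p i then [:0, 1:] else 0) - [:adjacency G i (p i):]"
  have along: "?t p = monom ((-1) ^ (card ?V - card (unmatched p))) (card (unmatched p))"
    if p: "edge_permutation p" for p
  proof -
    have "?t p = (\<Prod>i\<in>?V. if i \<in> unmatched p then [:0, 1:] else [:-1:])"
    proof (rule prod.cong[OF refl])
      fix i assume "i \<in> ?V"
      then show "(if i = p i then [:0, 1:] else 0) - [:adjacency G i (p i):]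
          = (if i \<in> unmatched p then [:0, 1:] else [:-1:])"
        using p adj_irrefl[of i] unfolding edge_permutation_def unmatched_def adjacency_def by auto
    qed
    also have "\<dots> = [:0, 1:] ^ card (?V \<inter> unmatched p) * [:-1:] ^ card (?V \<inter> - unmatched p)"
      using finite_V by (simp add: prod.If_cases)
    also have "?V \<inter> unmatched p = unmatched p" by (auto simp: unmatched_def)
    also have "?V \<inter> - unmatched p = ?V - unmatched p" by blast
    also have "card (?V - unmatched p) = card ?V - card (unmatched p)"
      by (intro card_Diff_subset finite_unmatched) (auto simp: unmatched_def)
    finally show ?thesis by (simp add: poly_const_pow monom_altdef)
  qed
  have other: "?t p = 0" if p: "p permutes ?V" "\<not> edge_permutation p" for p
  proof -
    obtain x where x: "p x \<noteq> x" "\<not> x \<rightarrow>\<^bsub>G\<^esub> p x" using p unfolding edge_permutation_def by blast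
    then have "x \<in> ?V" using p by (metis permutes_not_in)
    then show ?thesis using x finite_V by (intro prod_zero bexI[of _ x]) (auto simp: adjacency_def)
  qed
  have "coeff (permanental_poly G) k = (\<Sum>p | p permutes ?V. coeff (?t p) k)"
    unfolding permanental_poly_def permanent_def by (simp add: coeff_sum)
  also have "\<dots> = (\<Sum>p | p permutes ?V. if edge_permutation p \<and> card (unmatched p) = k
      then (-1) ^ (card ?V - k) else 0)"
  proof (rule sum.cong[OF refl])
    fix p assume "p \<in> {p. p permutes ?V}"
    then show "coeff (?t p) k = (if edge_permutation p \<and> card (unmatched p) = k then (-1) ^ (card ?V - k) else 0)"
      using other[of p] along[of p] by (cases "edge_permutation p") simp_all
  qed
  also have "\<dots> = (-1) ^ (card ?V - k) * real (card ({p. p permutes ?V} \<inter> {p. edge_permutation p \<and> card (unmatched p) = k}))"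
    using finite_permutations[OF finite_V] by (simp add: sum.If_cases)
  also have "{p. p permutes ?V} \<inter> {p. edge_permutation p \<and> card (unmatched p) = k}
      = {p. edge_permutation p \<and> card (unmatched p) = k}"
    by (auto simp: edge_permutation_def)
  finally show ?thesis .
qed

lemma permanental_nullity_eqI:
  assumes G: "Digraph.graph G"
    and ex: "\<exists>p. simple_graph.edge_permutation (verts G) (\<lambda>u v. u \<rightarrow>\<^bsub>G\<^esub> v) p
      \<and> card (simple_graph.unmatched (verts G) p) = k"
    and least: "\<And>p. simple_graph.edge_permutation (verts G) (\<lambda>u v. u \<rightarrow>\<^bsub>G\<^esub> v) p
      \<Longrightarrow> k \<le> card (simple_graph.unmatched (verts G) p)"
  shows "permanental_nullity G = k"
proof -
  interpret simple_graph "verts G" "\<lambda>u v. u \<rightarrow>\<^bsub>G\<^esub> v"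
    by (rule simple_graph_of_graph[OF G])
  let ?P = "permanental_poly G"
  have "finite {p. edge_permutation p \<and> card (unmatched p) = k}"
    using finite_permutations[OF finite_V] by (rule rev_finite_subset) (auto simp: edge_permutation_def)
  then have "card {p. edge_permutation p \<and> card (unmatched p) = k} \<noteq> 0"
    using ex by auto
  then have nz: "coeff ?P k \<noteq> 0" by (simp add: coeff_permanental_poly[OF G])
  have z: "coeff ?P l = 0" if "l < k" for l
  proof -
    have none: "{p. edge_permutation p \<and> card (unmatched p) = l} = {}"
      using least that by fastforce
    show ?thesis unfolding coeff_permanental_poly[OF G] none by simp
  qed
  have "?P \<noteq> 0" using nz by auto
  then have "\<And>j. j \<le> order 0 ?P \<longleftrightarrow> (\<forall>l<j. coeff ?P l = 0)"
    by (simp add: monom_1_dvd_iff[symmetric] monom_1_dvd_iff')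
  with nz z have "k \<le> order 0 ?P" "\<not> Suc k \<le> order 0 ?P" by blast+
  then show ?thesis unfolding permanental_nullity_def by simp
qed

section \<open>Matchings as edge sets and as involutions\<close>

lemma card_covered:
  assumes "Digraph.graph G" "matching G M"
  shows "card (covered M) = 2 * card M" "covered M \<subseteq> verts G"
proof -
  interpret simple_graph "verts G" "\<lambda>u v. u \<rightarrow>\<^bsub>G\<^esub> v"
    by (rule simple_graph_of_graph[OF assms(1)])
  have e: "card e = 2" "e \<subseteq> verts G" if "e \<in> M" for e
  proof -
    have "e \<in> edges G" using that assms(2) unfolding matching_def by blast
    then obtain u v where "e = {u, v}" "u \<rightarrow>\<^bsub>G\<^esub> v" unfolding edges_def by blast
    then show "card e = 2" "e \<subseteq> verts G"
      using adj_irrefl[of u] adj_in_V[of u v] adj_in_V[of v u] adj_sym[of u v] by (auto simp: card_insert_if)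
  qed
  have cov: "covered M = \<Union> M" by (auto simp: covered_def)
  have "card (\<Union> M) = (\<Sum>e\<in>M. card e)"
    using assms(2) e finite_V by (intro card_Union_disjoint) (auto simp: matching_def intro: finite_subset)
  then show "card (covered M) = 2 * card M" using e cov by simp
  show "covered M \<subseteq> verts G" using e cov by auto
qed

lemma pairing_of_matching:
  assumes "Digraph.graph G" "matching G M"
  shows "\<exists>m. simple_graph.pairing (\<lambda>u v. u \<rightarrow>\<^bsub>G\<^esub> v) m
    \<and> simple_graph.unmatched (verts G) m = verts G - covered M"
proof -
  interpret simple_graph "verts G" "\<lambda>u v. u \<rightarrow>\<^bsub>G\<^esub> v"
    by (rule simple_graph_of_graph[OF assms(1)])
  let ?m = "\<lambda>x. if x \<in> covered M then THE y. {x, y} \<in> M else x"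
  have ex1: "\<exists>!y. {x, y} \<in> M" if x: "x \<in> covered M" for x
  proof -
    obtain e where e: "e \<in> M" "x \<in> e" using x by (auto simp: covered_def)
    then obtain u v where "e = {u, v}" using assms(2) unfolding matching_def edges_def by blast
    then have "\<exists>y. {x, y} \<in> M" using e by (metis insert_commute insert_iff singletonD)
    moreover have "y = z" if "{x, y} \<in> M" "{x, z} \<in> M" for y z
    proof -
      have "{x, y} = {x, z}"
        using assms(2) that unfolding matching_def by (meson disjnt_insert1 insertI1 pairwiseD)
      then show ?thesis by (auto simp: doubleton_eq_iff)
    qed
    ultimately show ?thesis by blast
  qed
  have mM: "{x, ?m x} \<in> M" if "x \<in> covered M" for x
    using theI'[OF ex1[OF that]] that by simp
  have m_eq: "?m x = y" if "{x, y} \<in> M" for x y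
  proof -
    have "x \<in> covered M" using that by (auto simp: covered_def)
    then show ?thesis using ex1 mM that by blast
  qed
  have adj: "x \<rightarrow>\<^bsub>G\<^esub> ?m x" if x: "x \<in> covered M" for x
  proof -
    have "{x, ?m x} \<in> edges G" using mM[OF x] assms(2) unfolding matching_def by blast
    then show ?thesis unfolding edges_def using adj_sym by (auto simp: doubleton_eq_iff)
  qed
  have "?m (?m x) = x" for x
  proof (cases "x \<in> covered M")
    case True
    then show ?thesis using m_eq[of "?m x" x] mM[OF True] by (simp add: insert_commute)
  qed simp
  moreover have "?m x \<noteq> x \<longrightarrow> x \<rightarrow>\<^bsub>G\<^esub> ?m x" for x using adj by (cases "x \<in> covered M") auto
  ultimately have "pairing ?m" unfolding pairing_def by blast
  moreover have "?m x = x \<longleftrightarrow> x \<notin> covered M" for x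
    using adj[of x] adj_irrefl[of x] by (cases "x \<in> covered M") auto
  then have "unmatched ?m = verts G - covered M" by (auto simp only: unmatched_def)
  ultimately show ?thesis by blast
qed

lemma matching_of_pairing:
  assumes "Digraph.graph G" "simple_graph.pairing (\<lambda>u v. u \<rightarrow>\<^bsub>G\<^esub> v) m"
  shows "\<exists>M. matching G M \<and> simple_graph.unmatched (verts G) m = verts G - covered M"
proof -
  interpret simple_graph "verts G" "\<lambda>u v. u \<rightarrow>\<^bsub>G\<^esub> v"
    by (rule simple_graph_of_graph[OF assms(1)])
  note inv = pairing_involution[OF assms(2)] and adj = pairing_adj[OF assms(2)]
  let ?M = "{{x, m x} | x. m x \<noteq> x}"
  have "?M \<subseteq> edges G" using adj unfolding edges_def by blast
  moreover have "pairwise disjnt ?M"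
    by (rule pairwiseI) (use inv in \<open>auto simp: disjnt_def; metis\<close>)
  ultimately have "matching G ?M" by (simp add: matching_def)
  moreover have "x \<in> covered ?M \<longleftrightarrow> m x \<noteq> x" for x
    using inv unfolding covered_def by auto
  then have "unmatched m = verts G - covered ?M" by (auto simp: unmatched_def)
  ultimately show ?thesis by blast
qed

lemma card_unmatched_matching:
  assumes "Digraph.graph G" "matching G M" "simple_graph.unmatched (verts G) m = verts G - covered M"
  shows "card (simple_graph.unmatched (verts G) m) + 2 * card M = card (verts G)"
proof -
  interpret simple_graph "verts G" "\<lambda>u v. u \<rightarrow>\<^bsub>G\<^esub> v"
    by (rule simple_graph_of_graph[OF assms(1)])
  note c = card_covered[OF assms(1,2)]
  show ?thesis
    using assms(3) c card_Diff_subset[OF finite_subset[OF c(2) finite_V] c(2)]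
      card_mono[OF finite_V c(2)] by simp
qed

lemma maximum_matching_iff_optimal:
  assumes G: "Digraph.graph G" and M: "matching G M"
    and m: "simple_graph.pairing (\<lambda>u v. u \<rightarrow>\<^bsub>G\<^esub> v) m"
    and eq: "simple_graph.unmatched (verts G) m = verts G - covered M"
  shows "maximum_matching G M \<longleftrightarrow> simple_graph.optimal (verts G) (\<lambda>u v. u \<rightarrow>\<^bsub>G\<^esub> v) m"
proof -
  interpret simple_graph "verts G" "\<lambda>u v. u \<rightarrow>\<^bsub>G\<^esub> v"
    by (rule simple_graph_of_graph[OF G])
  note cM = card_unmatched_matching[OF G M eq]
  show ?thesis
  proof
    assume max: "maximum_matching G M"
    have "card (unmatched m) \<le> card (unmatched n)" if "pairing n" for n
    proof -
      obtain N where N: "matching G N" "unmatched n = verts G - covered N"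
        using matching_of_pairing[OF G \<open>pairing n\<close>] by blast
      then show ?thesis
        using max cM card_unmatched_matching[OF G N] unfolding maximum_matching_def by fastforce
    qed
    then show "optimal m" using m by (simp add: optimal_def)
  next
    assume opt: "optimal m"
    have "card N \<le> card M" if N: "matching G N" for N
    proof -
      obtain n where n: "pairing n" "unmatched n = verts G - covered N"
        using pairing_of_matching[OF G N] by blast
      then show ?thesis
        using opt cM card_unmatched_matching[OF G N n(2)] unfolding optimal_def by fastforce
    qed
    then show "maximum_matching G M" using M by (simp add: maximum_matching_def)
  qed
qed

lemma inessential_eq_D_verts:
  assumes G: "Digraph.graph G"
  shows "simple_graph.inessential (verts G) (\<lambda>u v. u \<rightarrow>\<^bsub>G\<^esub> v) = D_verts G"
proof -
  interpret simple_graph "verts G" "\<lambda>u v. u \<rightarrow>\<^bsub>G\<^esub> v"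
    by (rule simple_graph_of_graph[OF G])
  have "(\<exists>m. optimal m \<and> m x = x) \<longleftrightarrow> (\<exists>M. maximum_matching G M \<and> x \<notin> covered M)" if "x \<in> verts G" for x
  proof
    assume "\<exists>m. optimal m \<and> m x = x"
    then obtain m where m: "optimal m" "m x = x" by blast
    obtain M where M: "matching G M" "unmatched m = verts G - covered M"
      using matching_of_pairing[OF G optimal_pairing[OF m(1)]] by blast
    then show "\<exists>M. maximum_matching G M \<and> x \<notin> covered M"
      using maximum_matching_iff_optimal[OF G M(1) optimal_pairing[OF m(1)] M(2)] m that
      by (auto simp: unmatched_def)
  next
    assume "\<exists>M. maximum_matching G M \<and> x \<notin> covered M"
    then obtain M where M: "maximum_matching G M" "x \<notin> covered M" by blast
    then have mM: "matching G M" by (simp add: maximum_matching_def)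
    obtain m where m: "pairing m" "unmatched m = verts G - covered M"
      using pairing_of_matching[OF G mM] by blast
    then have "x \<in> unmatched m" using M that by blast
    then show "\<exists>m. optimal m \<and> m x = x"
      using maximum_matching_iff_optimal[OF G mM m] M by (auto simp: unmatched_def)
  qed
  then show ?thesis unfolding inessential_def D_verts_def by blast
qed

section \<open>Components of the subgraph induced by the inessential vertices\<close>

lemma dominates_D_graph:
  "u \<rightarrow>\<^bsub>D_graph G\<^esub> v \<longleftrightarrow> u \<rightarrow>\<^bsub>G\<^esub> v \<and> u \<in> D_verts G \<and> v \<in> D_verts G"
  by (auto simp: D_graph_def arcs_ends_conv)

lemma verts_D_graph: "verts (D_graph G) = D_verts G"
  by (simp add: D_graph_def)

lemma isolated_eq_isolated_verts:
  assumes "Digraph.graph G"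
  shows "simple_graph.isolated (verts G) (\<lambda>u v. u \<rightarrow>\<^bsub>G\<^esub> v) = isolated_verts (D_graph G)"
  using simple_graph.isolated_def[OF simple_graph_of_graph[OF assms]]
  by (auto simp: isolated_verts_def inessential_eq_D_verts[OF assms] verts_D_graph dominates_D_graph)

lemma reachable_D_graph:
  assumes G: "Digraph.graph G" and u: "u \<in> D_verts G"
  shows "u \<rightarrow>\<^sup>*\<^bsub>D_graph G\<^esub> v \<longleftrightarrow> simple_graph.linked (verts G) (\<lambda>u v. u \<rightarrow>\<^bsub>G\<^esub> v) u v"
proof -
  interpret simple_graph "verts G" "\<lambda>u v. u \<rightarrow>\<^bsub>G\<^esub> v"
    by (rule simple_graph_of_graph[OF G])
  interpret G: Digraph.graph G by fact
  interpret H: wf_digraph "D_graph G" unfolding D_graph_def by (rule G.wellformed_induce_subgraph)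
  have *: "(\<lambda>x y. x \<in> inessential \<and> y \<in> inessential \<and> x \<rightarrow>\<^bsub>G\<^esub> y) = (\<lambda>x y. x \<rightarrow>\<^bsub>D_graph G\<^esub> y)"
    by (auto simp: inessential_eq_D_verts[OF G] dominates_D_graph)
  show ?thesis
  proof
    show "linked u v" if "u \<rightarrow>\<^sup>*\<^bsub>D_graph G\<^esub> v"
      using that unfolding linked_def *
      by (induction rule: H.reachable_induct) (auto intro: rtranclp.rtrancl_into_rtrancl)
    show "u \<rightarrow>\<^sup>*\<^bsub>D_graph G\<^esub> v" if "linked u v"
      using that unfolding linked_def *
      by (induction rule: rtranclp_induct) (auto simp: verts_D_graph u intro: H.reachable_adj_trans)
  qed
qed

lemma card_missed_components:
  assumes G: "Digraph.graph G"
    and m: "simple_graph.optimal (verts G) (\<lambda>u v. u \<rightarrow>\<^bsub>G\<^esub> v) m"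
    and eq: "simple_graph.unmatched (verts G) m = verts G - covered M"
  shows "card (missed_components G M)
    = card (simple_graph.unmatched (verts G) m - isolated_verts (D_graph G))"
proof -
  interpret simple_graph "verts G" "\<lambda>u v. u \<rightarrow>\<^bsub>G\<^esub> v"
    by (rule simple_graph_of_graph[OF G])
  interpret G: Digraph.graph G by fact
  interpret H: wf_digraph "D_graph G" unfolding D_graph_def by (rule G.wellformed_induce_subgraph)
  have DV: "D_verts G \<subseteq> verts G" by (auto simp: D_verts_def)
  have scc: "H.scc_of u = {v. linked u v}" if u: "u \<in> D_verts G" for u
  proof -
    have "v \<rightarrow>\<^sup>*\<^bsub>D_graph G\<^esub> u" if "linked u v" for v
      using linked_inessential[OF that] linked_sym[OF that] u reachable_D_graph[OF G, of v u]
      by (simp add: inessential_eq_D_verts[OF G])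
    then show ?thesis
      unfolding H.scc_of_def using reachable_D_graph[OF G u] by blast
  qed
  have "card (missed_components G M) = card (verts ` missed_components G M)"
    by (rule card_image[symmetric], rule inj_on_subset[OF H.inj_on_verts_sccs])
       (auto simp: missed_components_def nontrivial_components_def)
  also have "verts ` missed_components G M
      = {S \<in> H.sccs_verts. 3 \<le> card S \<and> card (S - covered M) = 1}"
    unfolding H.sccs_verts_conv missed_components_def nontrivial_components_def by blast
  also have "\<dots> = {S. \<exists>u\<in>inessential. S = {v. linked u v} \<and> 3 \<le> card S \<and> card (S \<inter> unmatched m) = 1}"
  proof -
    have "S - covered M = S \<inter> unmatched m" if "S \<in> H.sccs_verts" for S
      using H.sccs_verts_subsets[OF that] eq DV by (auto simp: verts_D_graph)
    moreover have "H.sccs_verts = (\<lambda>u. {v. linked u v}) ` inessential"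
      unfolding H.sccs_verts_conv_scc_of verts_D_graph inessential_eq_D_verts[OF G]
      by (rule image_cong) (auto simp: scc)
    ultimately show ?thesis by auto
  qed
  also have "card \<dots> = card (unmatched m - isolated)"
    by (rule card_big_components_missed[OF m])
  finally show ?thesis by (simp add: isolated_eq_isolated_verts[OF G])
qed

theorem theorem3p5:
  fixes G :: "('a, 'b) pre_digraph" and M :: "'a set set" and n :: nat
  assumes "Digraph.graph G"
    and "Digraph_Component.connected G"
    and "card (verts G) = n"
    and "maximum_matching G M"
    and "\<And>N. maximum_matching G N \<Longrightarrow>
           card (isolated_verts (D_graph G) \<inter> covered N)
             \<le> card (isolated_verts (D_graph G) \<inter> covered M)"
  shows "int (permanental_nullity G) =
    (if (\<exists>P. perfect_matching G P) \<or> nontrivial_components G = {}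
     then int n - 2 * int (matching_number G)
     else int n - 2 * int (matching_number G) - int (card (missed_components G M)))"
proof -
  note G = assms(1)
  interpret simple_graph "verts G" "\<lambda>u v. u \<rightarrow>\<^bsub>G\<^esub> v"
    by (rule simple_graph_of_graph[OF G])
  let ?I = "isolated_verts (D_graph G)"
  have I: "isolated = ?I" by (rule isolated_eq_isolated_verts[OF G])
  have IV: "?I \<subseteq> verts G" unfolding I[symmetric] by (auto simp: isolated_def inessential_def)
  have M: "matching G M" using assms(4) by (simp add: maximum_matching_def)
  obtain m where m: "pairing m" "unmatched m = verts G - covered M"
    using pairing_of_matching[OF G M] by blast
  have opt: "optimal m" using maximum_matching_iff_optimal[OF G M m] assms(4) by simp
  \<comment> \<open>Covering most isolated vertices is the same as missing fewest.\<close>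
  have split: "card (unmatched k \<inter> isolated) + card (?I \<inter> covered K) = card ?I"
    if "unmatched k = verts G - covered K" for k K
  proof -
    have "unmatched k \<inter> isolated = ?I - ?I \<inter> covered K" using that I IV by blast
    then show ?thesis
      using card_Diff_subset[of "?I \<inter> covered K" ?I] card_mono[of ?I "?I \<inter> covered K"]
        finite_subset[OF IV finite_V] by simp
  qed
  have most: "card (unmatched m \<inter> isolated) \<le> card (unmatched k \<inter> isolated)" if k: "optimal k" for k
  proof -
    obtain K where K: "matching G K" "unmatched k = verts G - covered K"
      using matching_of_pairing[OF G optimal_pairing[OF k]] by blast
    then have "maximum_matching G K"
      using maximum_matching_iff_optimal[OF G K(1) optimal_pairing[OF k] K(2)] k by simp
    from assms(5)[OF this] show ?thesis using split[OF m(2)] split[OF K(2)] by linarith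
  qed
  have nullity: "permanental_nullity G = card (unmatched m \<inter> isolated)"
    using least_fixed_edge_permutation[OF opt most] by (intro permanental_nullity_eqI[OF G]) auto
  have missed: "card (unmatched m) = card (unmatched m \<inter> isolated) + card (missed_components G M)"
  proof -
    have "card (unmatched m) = card (unmatched m \<inter> isolated) + card (unmatched m - isolated)"
      by (subst card_Un_disjoint[symmetric]) (auto simp: finite_unmatched Un_Diff_Int Int_Diff_Un)
    then show ?thesis using card_missed_components[OF G opt m(2)] I by simp
  qed
  have size: "card (unmatched m) + 2 * card M = n"
    using card_unmatched_matching[OF G M m(2)] assms(3) by simp
  have nu: "matching_number G = card M"
  proof -
    have "{N. matching G N} \<subseteq> Pow (Pow (verts G))"
      using card_covered(2)[OF G] by (fastforce simp: covered_def)
    then have "finite {N. matching G N}" using finite_V by (meson finite_Pow_iff finite_subset)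
    then show ?thesis
      unfolding matching_number_def using assms(4) M
      by (intro Max_eqI) (auto simp: maximum_matching_def)
  qed
  have formula: "int (permanental_nullity G)
      = int n - 2 * int (matching_number G) - int (card (missed_components G M))"
    using nullity missed size nu by linarith
  have no_missed: "card (missed_components G M) = 0"
    if "(\<exists>P. perfect_matching G P) \<or> nontrivial_components G = {}"
    using that
  proof
    assume "\<exists>P. perfect_matching G P"
    then obtain P where P: "matching G P" "verts G \<subseteq> covered P" by (auto simp: perfect_matching_def)
    obtain p where p: "pairing p" "unmatched p = verts G - covered P"
      using pairing_of_matching[OF G P(1)] by blast
    then have "card (unmatched p) = 0" using P by (simp add: Diff_eq_empty_iff[THEN iffD2])
    then have "card (unmatched m) = 0" using opt p(1) unfolding optimal_def by (metis le_zero_eq)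
    then show ?thesis using missed by simp
  next
    assume "nontrivial_components G = {}"
    then show ?thesis by (simp add: missed_components_def)
  qed
  show ?thesis
  proof (cases "(\<exists>P. perfect_matching G P) \<or> nontrivial_components G = {}")
    case True
    show ?thesis unfolding if_P[OF True] using formula no_missed[OF True] by simp
  next
    case False
    show ?thesis unfolding if_not_P[OF False] by (rule formula)
  qed
qed

end
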